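(* Let $n\ge 1$ be an integer. Among all rooted trees with $n$ vertices, the rooted path $P_n$ uniquely maximises the level energy; that is, for every rooted tree $T$ with $n$ vertices, $E_L(T)\le E_L(P_n)$, with equality if and only if $T$ is (isomorphic as a rooted tree to) $P_n$.
   Context: A rooted tree is a finite tree with a distinguished vertex (the root). The level $l(v)$ of a vertex $v$ is its distance from the root. For a rooted tree $T$ with vertices $v_1,\dots,v_n$, the level matrix $L(T)=(l_{ij})$ is the $n\times n$ real symmetric matrix with $l_{ij}=|l(v_i)-l(v_j)|$. The level energy $E_L(T)$ is the sum of the absolute values of the eigenvalues of $L(T)$, counted with multiplicity. The rooted path $P_n$ is the $n$-vertex path rooted at one of its endvertices. *)

theory Defs
  imports "Graph_Theory.Graph_Theory" "Jordan_Normal_Form.Char_Poly"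
begin

text \<open>
  Undirected simple graphs are finite symmetric loop-free relations
  (\<^locale>\<open>pair_graph\<close>): each edge is a pair of opposite arcs.  Such a pair is itself a
  directed cycle of length 2, so the predicate \<^const>\<open>tree\<close> of the library does not
  describe undirected trees; an undirected cycle is a directed cycle of length at least 3.
\<close>

definition rooted_tree :: "'a pair_pre_digraph \<Rightarrow> 'a \<Rightarrow> bool" where
  "rooted_tree T r \<longleftrightarrow>
     pair_graph T \<and> connected T \<and> \<not> (\<exists>p. pre_digraph.cycle T p \<and> 3 \<le> length p) \<and>
     r \<in> pverts T"

definition level :: "'a pair_pre_digraph \<Rightarrow> 'a \<Rightarrow> 'a \<Rightarrow> nat" where
  "level T r v = (LEAST k. \<exists>p. pre_digraph.awalk T r p v \<and> length p = k)"

definition level_matrix :: "'a pair_pre_digraph \<Rightarrow> 'a \<Rightarrow> 'a list \<Rightarrow> real mat" where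
  "level_matrix T r vs = mat (length vs) (length vs)
     (\<lambda>(i, j). \<bar>real (level T r (vs ! i)) - real (level T r (vs ! j))\<bar>)"

text \<open>
  Only meant for real matrices all of whose complex eigenvalues are real, such as symmetric ones.
\<close>

definition energy :: "real mat \<Rightarrow> real" where
  "energy A = (\<Sum>x | eigenvalue A x. real (order x (char_poly A)) * \<bar>x\<bar>)"

text \<open>
  The chosen enumeration of the vertices is immaterial, see \<open>level_energy_eq\<close> below.
\<close>

definition level_energy :: "'a pair_pre_digraph \<Rightarrow> 'a \<Rightarrow> real" where
  "level_energy T r =
     energy (level_matrix T r (SOME vs. distinct vs \<and> set vs = pverts T))"

text \<open>The path on \<open>n\<close> vertices; its root is the endvertex \<open>0\<close>.\<close>

definition rooted_path :: "nat \<Rightarrow> nat pair_pre_digraph" where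
  "rooted_path n = \<lparr> pverts = {..<n},
     parcs = {(i, j). i < n \<and> j < n \<and> (j = Suc i \<or> i = Suc j)} \<rparr>"

definition rooted_iso ::
  "'a pair_pre_digraph \<Rightarrow> 'a \<Rightarrow> 'b pair_pre_digraph \<Rightarrow> 'b \<Rightarrow> bool" where
  "rooted_iso G r H s \<longleftrightarrow>
     (\<exists>f. pre_digraph.digraph_isomorphism G f \<and> with_proj H = app_iso f G \<and>
          iso_verts f r = s)"


lemma level_eq_\<mu>:
  assumes "pair_wf_digraph T" "r \<rightarrow>\<^sup>*\<^bsub>with_proj T\<^esub> v"
  shows "ereal (real (level T r v)) = wf_digraph.\<mu> T (\<lambda>_. 1) r v"
proof -
  interpret pair_wf_digraph T by fact
  have cost: "awalk_cost (\<lambda>_. 1) p = real (length p)" for p :: "('a \<times> 'a) list"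
    by (induction p) (auto simp: awalk_cost_def)
  have "\<exists>k p. awalk r p v \<and> length p = k"
    using assms(2) by (simp add: reachable_awalk)
  hence "\<exists>p. awalk r p v \<and> length p = level T r v"
    unfolding level_def by (rule LeastI_ex)
  then obtain p where p: "awalk r p v" "length p = level T r v" by blast
  have min: "level T r v \<le> length q" if "awalk r q v" for q
    unfolding level_def using that by (intro Least_le) blast
  show ?thesis
    unfolding \<mu>_def cost using p min
    by (intro antisym INF_greatest) (auto intro!: INF_lower2[of p])
qed

lemma char_poly_permute:
  fixes A :: "'a :: comm_ring_1 mat"
  assumes A: "A \<in> carrier_mat n n" and p: "p permutes {0..<n}"
  shows "char_poly (mat n n (\<lambda>(i, j). A $$ (p i, p j))) = char_poly A"
proof -
  define B where "B = char_poly_matrix A"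
  define C where "C = mat n n (\<lambda>(i, j). B $$ (p i, j))"
  define D where "D = mat n n (\<lambda>(i, j). transpose_mat C $$ (p i, j))"
  have B: "B \<in> carrier_mat n n" using A by (simp add: B_def)
  have C: "C \<in> carrier_mat n n" by (simp add: C_def)
  have D: "D \<in> carrier_mat n n" by (simp add: D_def)
  have pn: "p i < n" if "i < n" for i using permutes_in_image[OF p, of i] that by simp
  have pinj: "p i = p j \<longleftrightarrow> i = j" for i j using permutes_inj[OF p] by (simp add: inj_eq)
  have eq: "char_poly_matrix (mat n n (\<lambda>(i, j). A $$ (p i, p j))) = transpose_mat D"
    using A by (intro eq_matI)
      (auto simp: D_def C_def B_def char_poly_matrix_def pn pinj)
  have dC: "det C = signof p * det B"
    unfolding C_def by (rule det_permute_rows[OF B p])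
  have dD: "det D = signof p * det (transpose_mat C)"
    unfolding D_def by (rule det_permute_rows[OF _ p]) (use C in simp)
  have "det (transpose_mat D) = signof p * (signof p * det B)"
    by (simp add: det_transpose[OF D] dD det_transpose[OF C] dC)
  also have "\<dots> = det B"
    by (simp add: sign_def)
  finally show ?thesis by (simp add: char_poly_def eq B_def)
qed

lemma energy_cong_char_poly:
  assumes "A \<in> carrier_mat n n" "B \<in> carrier_mat m m" "char_poly A = char_poly B"
  shows "energy A = energy B"
  using assms by (simp add: energy_def eigenvalue_root_char_poly)

lemma level_energy_eq:
  assumes vs: "distinct vs" "set vs = pverts T"
  shows "level_energy T r = energy (level_matrix T r vs)"
proof -
  define ws where "ws = (SOME ws. distinct ws \<and> set ws = pverts T)"
  have ws: "distinct ws \<and> set ws = pverts T"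
    unfolding ws_def by (rule someI[of _ vs]) (use vs in simp)
  have "mset ws = mset vs"
    using vs ws set_eq_iff_mset_eq_distinct[of ws vs] by simp
  then obtain p where p: "p permutes {..<length vs}" "permute_list p vs = ws"
    by (rule mset_eq_permutation)
  have pn: "p i < length vs" if "i < length vs" for i
    using permutes_in_image[OF p(1), of i] that by simp
  have len: "length ws = length vs" using p(2) by auto
  have nth: "ws ! i = vs ! p i" if "i < length vs" for i
    using permute_list_nth[OF p(1) that] p(2) by simp
  have car: "level_matrix T r us \<in> carrier_mat (length us) (length us)" for us
    by (simp add: level_matrix_def)
  have "level_matrix T r ws =
      mat (length vs) (length vs) (\<lambda>(i, j). level_matrix T r vs $$ (p i, p j))"
    by (intro eq_matI) (auto simp: level_matrix_def len nth pn)
  hence "char_poly (level_matrix T r ws) = char_poly (level_matrix T r vs)"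
    using char_poly_permute[OF car[of vs], of p] p(1) by (simp add: atLeast0LessThan)
  thus ?thesis
    unfolding level_energy_def ws_def[symmetric] by (rule energy_cong_char_poly[OF car car])
qed

end

theory Submission
  imports Defs "Jordan_Normal_Form.Schur_Decomposition"
begin

text \<open>
  The level matrix is the distance matrix of the points \<open>l(v)\<close> on a line, and such a matrix is of
  negative type: its quadratic form is nonpositive on vectors with coordinate sum zero
  (\<open>line_distances_negative_type\<close>), because the line metric is a sum of cut metrics.  A form that is
  nonpositive on a hyperplane has at most one positive eigenvalue, and the trace of the matrix is
  zero, so the energy is twice the largest eigenvalue (\<open>negative_type_energy\<close>).  For nonnegative
  matrices that quantity is monotone in the entries, and strictly so below a matrix that is positive
  off the diagonal (\<open>energy_mono_negative_type\<close>).

  It remains to compare entries.  The set of levels of a rooted tree is an initial segment of the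
  natural numbers, so when the vertices are listed by increasing level, consecutive levels differ
  by at most one, whence \<open>\<bar>l(v\<^sub>i) - l(v\<^sub>j)\<bar> \<le> \<bar>i - j\<bar>\<close> (\<open>sorted_downward_closed_gap\<close>).  The right-hand
  side is the level matrix of the path.  Equality forces the levels to be \<open>0, \<dots>, n - 1\<close>, each
  attained once, and a rooted tree with these levels is the path
  (\<open>rooted_iso_path_of_bij_levels\<close>).
\<close>

section \<open>The spectral theorem for real symmetric matrices\<close>

text \<open>
  A complex root \<open>c\<close> of the characteristic polynomial has a complex eigenvector \<open>v\<close>.  The number
  \<open>v\<^sup>* A v = c \<parallel>v\<parallel>\<^sup>2\<close> equals its own conjugate because \<open>A\<close> is real and symmetric, so \<open>c\<close> is real
  and is already a root over the reals.
\<close>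

lemma symmetric_real_eigenvalue_exists:
  fixes A :: "real mat"
  assumes A: "A \<in> carrier_mat n n" and sym: "transpose_mat A = A" and n: "n > 0"
  shows "\<exists>e. eigenvalue A e"
proof -
  define C where "C = map_mat complex_of_real A"
  have C: "C \<in> carrier_mat n n" using A by (simp add: C_def)
  have symA: "A $$ (i, j) = A $$ (j, i)" if "i < n" "j < n" for i j
    using index_transpose_mat(1)[of j A i] A sym that by simp
  obtain as where as: "char_poly C = (\<Prod>a\<leftarrow>as. [:- a, 1:])" "length as = n"
    using char_poly_factorized[OF C] by auto
  then obtain c where "c \<in> set as" using n by (cases as) auto
  hence root: "poly (char_poly C) c = 0"
    unfolding as(1) poly_prod_list by (auto simp: prod_list_zero_iff)
  hence "eigenvalue C c" using eigenvalue_root_char_poly[OF C] by simp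
  then obtain v where v: "v \<in> carrier_vec n" "v \<noteq> 0\<^sub>v n" "C *\<^sub>v v = c \<cdot>\<^sub>v v"
    unfolding eigenvalue_def eigenvector_def using C by auto
  have ev: "(\<Sum>j<n. complex_of_real (A $$ (i, j)) * v $ j) = c * v $ i" if "i < n" for i
  proof -
    have "(C *\<^sub>v v) $ i = (\<Sum>j<n. complex_of_real (A $$ (i, j)) * v $ j)"
      using A v(1) that by (simp add: C_def scalar_prod_def atLeast0LessThan)
    thus ?thesis using v(1,3) that by simp
  qed
  define N where "N = (\<Sum>i<n. cnj (v $ i) * v $ i)"
  define S where "S = (\<Sum>i<n. \<Sum>j<n. cnj (v $ i) * (complex_of_real (A $$ (i, j)) * v $ j))"
  have S: "S = c * N"
    by (simp add: S_def N_def sum_distrib_left[symmetric] ev)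
       (simp add: sum_distrib_left algebra_simps)
  have "cnj S = (\<Sum>i<n. \<Sum>j<n. cnj (v $ j) * (complex_of_real (A $$ (j, i)) * v $ i))"
    unfolding S_def cnj_sum
    by (intro sum.cong refl) (auto simp: symA algebra_simps)
  also have "\<dots> = S" unfolding S_def by (rule sum.swap)
  finally have cnjS: "cnj S = S" .
  have N: "N = complex_of_real (\<Sum>i<n. (cmod (v $ i))\<^sup>2)"
    unfolding N_def of_real_sum
    by (intro sum.cong refl) (metis complex_norm_square mult.commute of_real_power)
  have "\<exists>i<n. v $ i \<noteq> 0"
    using v(1,2) by (metis carrier_vecD eq_vecI index_zero_vec)
  then obtain i where i: "i < n" "v $ i \<noteq> 0" by blast
  have "0 < (\<Sum>i<n. (cmod (v $ i))\<^sup>2)"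
    by (rule sum_pos2[of _ i]) (use i in auto)
  hence "N \<noteq> 0" "cnj N = N" by (auto simp: N simp flip: of_real_sum of_real_power)
  hence "cnj c = c" using S cnjS by auto
  hence "complex_of_real (Re c) = c" by (metis Reals_cnj_iff of_real_Re)
  moreover have "char_poly C = map_poly complex_of_real (char_poly A)"
    unfolding C_def by (rule of_real_hom.char_poly_hom[OF A])
  ultimately have "complex_of_real (poly (char_poly A) (Re c)) = 0"
    using root by (metis of_real_hom.poly_map_poly)
  thus ?thesis using eigenvalue_root_char_poly[OF A] by auto
qed

text \<open>
  Gram--Schmidt turns a basis starting with \<open>u\<close> into an orthogonal one; normalising its members
  does not change the first of them because \<open>u\<close> already has length one.
\<close>

lemma orthonormal_completion:
  fixes u :: "real vec"
  assumes u: "u \<in> carrier_vec n" and unit: "u \<bullet> u = 1"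
  obtains W where "W \<in> carrier_mat n n" "transpose_mat W * W = 1\<^sub>m n"
    "W * transpose_mat W = 1\<^sub>m n" "col W 0 = u"
proof -
  interpret cof_vec_space n "TYPE(real)" .
  have u0: "u \<noteq> 0\<^sub>v n" using unit u by auto
  hence n: "n > 0" using u by (cases n) auto
  define b where "b = basis_completion u"
  define ws where "ws = gram_schmidt n b"
  from basis_completion[OF u u0, folded b_def]
  have dist_b: "distinct b" and indep: "\<not> lin_dep (set b)" and b: "set b \<subseteq> carrier_vec n"
    and hdb: "hd b = u" and len_b: "length b = n" by auto
  from hdb len_b n obtain vs where bv: "b = u # vs" by (cases b) auto
  from gram_schmidt_result[OF b dist_b indep refl, folded ws_def]
  have ws: "set ws \<subseteq> carrier_vec n" "corthogonal ws" "length ws = n"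
    by (auto simp: len_b)
  have "hd ws = u" using gram_schmidt_hd[OF u, of vs, folded bv] by (simp add: ws_def)
  hence ws0: "ws ! 0 = u" using ws(3) n by (metis hd_conv_nth list.size(3) not_less0)
  have wsc: "ws ! i \<in> carrier_vec n" if "i < n" for i using ws that by auto
  have orth: "ws ! i \<bullet> ws ! j = 0 \<longleftrightarrow> i \<noteq> j" if "i < n" "j < n" for i j
    using corthogonalD[OF ws(2), of i j] ws(3) that by simp
  have pos: "ws ! i \<bullet> ws ! i > 0" if "i < n" for i
  proof -
    have "ws ! i \<bullet> ws ! i \<ge> 0" by (simp add: scalar_prod_def sum_nonneg)
    thus ?thesis using orth[OF that that] by linarith
  qed
  define W where "W = mat_of_cols n (map (\<lambda>w. (1 / sqrt (w \<bullet> w)) \<cdot>\<^sub>v w) ws)"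
  have W: "W \<in> carrier_mat n n" using ws(3) by (auto simp: W_def)
  have colW: "col W i = (1 / sqrt (ws ! i \<bullet> ws ! i)) \<cdot>\<^sub>v ws ! i" if "i < n" for i
    using wsc[OF that] ws(3) that unfolding W_def by (subst col_mat_of_cols) auto
  have WW: "transpose_mat W * W = 1\<^sub>m n"
  proof (rule eq_matI)
    fix i j assume "i < dim_row (1\<^sub>m n :: real mat)" "j < dim_col (1\<^sub>m n :: real mat)"
    hence ij: "i < n" "j < n" by auto
    have "(transpose_mat W * W) $$ (i, j) = col W i \<bullet> col W j"
      using W ij by simp
    also have "\<dots> = 1 / sqrt (ws ! i \<bullet> ws ! i) * (1 / sqrt (ws ! j \<bullet> ws ! j)) * (ws ! i \<bullet> ws ! j)"
      using wsc[OF ij(1)] wsc[OF ij(2)] ij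
      by (simp add: colW smult_scalar_prod_distrib[of _ n] scalar_prod_smult_distrib[of _ n])
    also have "\<dots> = (if i = j then 1 else 0)"
      using orth[OF ij] pos[OF ij(1)] by (auto simp: divide_simps)
    finally show "(transpose_mat W * W) $$ (i, j) = 1\<^sub>m n $$ (i, j)" using ij by simp
  qed (use W in auto)
  moreover have "W * transpose_mat W = 1\<^sub>m n"
    using mat_mult_left_right_inverse[OF _ W WW] W by simp
  moreover have "col W 0 = u" using colW[OF n] ws0 unit u by simp
  ultimately show ?thesis using W that by blast
qed

text \<open>
  Deflation: complete a unit eigenvector to an orthogonal matrix \<open>W\<close>.  Then \<open>W\<^sup>T A W\<close> is still
  symmetric, and its first column, hence also its first row, vanishes off the diagonal.  The
  remaining block is a smaller symmetric matrix.
\<close>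

theorem real_spectral_theorem:
  fixes A :: "real mat"
  assumes "A \<in> carrier_mat n n" "transpose_mat A = A"
  shows "\<exists>U es. U \<in> carrier_mat n n \<and> transpose_mat U * U = 1\<^sub>m n \<and> length es = n \<and>
           A = U * (mat_diag n (\<lambda>i. es ! i) * transpose_mat U)"
  using assms
proof (induction n arbitrary: A)
  case 0
  thus ?case by (intro exI[of _ "1\<^sub>m 0"] exI[of _ "[]"]) auto
next
  case (Suc n)
  note A = Suc.prems(1)
  obtain e v where "eigenvector A v e"
    using symmetric_real_eigenvalue_exists[OF Suc.prems] by (auto simp: eigenvalue_def)
  hence v: "v \<in> carrier_vec (Suc n)" "v \<noteq> 0\<^sub>v (Suc n)" "A *\<^sub>v v = e \<cdot>\<^sub>v v"
    using A by (auto simp: eigenvector_def)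
  have vpos: "v \<bullet> v > 0"
    using conjugate_square_greater_0_vec[OF v(1)] v(2) by simp
  define u where "u = (1 / sqrt (v \<bullet> v)) \<cdot>\<^sub>v v"
  have u: "u \<in> carrier_vec (Suc n)" using v(1) by (simp add: u_def)
  have unit: "u \<bullet> u = 1" using v(1) vpos by (simp add: u_def)
  have Au: "A *\<^sub>v u = e \<cdot>\<^sub>v u"
    using v A by (simp add: u_def mult_mat_vec smult_smult_assoc mult.commute)
  obtain W where W: "W \<in> carrier_mat (Suc n) (Suc n)"
    and WtW: "transpose_mat W * W = 1\<^sub>m (Suc n)"
    and WWt: "W * transpose_mat W = 1\<^sub>m (Suc n)" and W0: "col W 0 = u"
    using orthonormal_completion[OF u unit] .
  define A' where "A' = transpose_mat W * (A * W)"
  have A': "A' \<in> carrier_mat (Suc n) (Suc n)" using W A by (simp add: A'_def)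
  have symA': "transpose_mat A' = A'"
    using W A Suc.prems(2) unfolding A'_def
    by (simp add: transpose_mult[of _ "Suc n" "Suc n" _ "Suc n"] assoc_mult_mat[of _ "Suc n" "Suc n" _ "Suc n" _ "Suc n"])
  have A'0: "A' $$ (i, 0) = (if i = 0 then e else 0)" if "i < Suc n" for i
  proof -
    have "A' $$ (i, 0) = col W i \<bullet> (A *\<^sub>v col W 0)"
      using W A that by (simp add: A'_def mult_mat_vec_def)
    also have "\<dots> = e * (col W i \<bullet> col W 0)"
      using W u by (simp add: W0 Au)
    also have "col W i \<bullet> col W 0 = (transpose_mat W * W) $$ (i, 0)"
      using W that by simp
    finally show ?thesis using that by (simp add: WtW)
  qed
  have A'0': "A' $$ (0, i) = (if i = 0 then e else 0)" if "i < Suc n" for i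
    using A'0[OF that] symA' A' that by (metis carrier_matD index_transpose_mat(1) zero_less_Suc)
  define B where "B = mat n n (\<lambda>(i, j). A' $$ (Suc i, Suc j))"
  have B: "B \<in> carrier_mat n n" by (simp add: B_def)
  have symB: "transpose_mat B = B"
  proof (rule eq_matI)
    fix i j assume "i < dim_row B" "j < dim_col B"
    hence ij: "i < n" "j < n" using B by auto
    have "A' $$ (Suc j, Suc i) = transpose_mat A' $$ (Suc i, Suc j)" using A' ij by simp
    thus "transpose_mat B $$ (i, j) = B $$ (i, j)" using ij by (simp add: B_def symA')
  qed (use B in auto)
  obtain V es where V: "V \<in> carrier_mat n n" "transpose_mat V * V = 1\<^sub>m n"
    and es: "length es = n" and Beq: "B = V * (mat_diag n (\<lambda>i. es ! i) * transpose_mat V)"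
    using Suc.IH[OF B symB] by blast
  let ?E = "mat 1 1 (\<lambda>_. e)" and ?D = "mat_diag n (\<lambda>i. es ! i)"
  let ?blk = "\<lambda>X Y. four_block_mat X (0\<^sub>m 1 n) (0\<^sub>m n 1) (Y :: real mat)"
  define F where "F = ?blk (1\<^sub>m 1) V"
  have F: "F \<in> carrier_mat (Suc n) (Suc n)" using V by (auto simp: F_def)
  have Ft: "transpose_mat F = ?blk (1\<^sub>m 1) (transpose_mat V)"
    unfolding F_def using V by (subst transpose_four_block_mat[of _ 1 1 _ n _ n]) auto
  have A'blk: "A' = ?blk ?E B"
    using A' by (intro eq_matI) (auto simp: A'0 A'0' B_def not_less_eq)
  have D: "mat_diag (Suc n) (\<lambda>i. (e # es) ! i) = ?blk ?E ?D"
    by (intro eq_matI) (auto simp: mat_diag_def nth_Cons')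
  have FtF: "transpose_mat F * F = 1\<^sub>m (Suc n)"
    unfolding Ft unfolding F_def using V
    by (subst mult_four_block_mat[of _ 1 1 _ n _ n _ _ 1 _ n]) (auto simp: four_block_one_mat)
  have FDF: "F * (?blk ?E ?D * transpose_mat F) = A'"
  proof -
    have DV: "?D * transpose_mat V \<in> carrier_mat n n" "?D * 0\<^sub>m n 1 = 0\<^sub>m n 1"
      using V by (auto intro!: mult_carrier_mat[of _ n n] right_mult_zero_mat[of _ n])
    have "?blk ?E ?D * transpose_mat F = ?blk ?E (?D * transpose_mat V)"
      unfolding Ft using V DV
      by (subst mult_four_block_mat[of _ 1 1 _ n _ n _ _ 1 _ n]) auto
    moreover have "F * ?blk ?E (?D * transpose_mat V) = ?blk ?E B"
      unfolding F_def Beq using V DV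
      by (subst mult_four_block_mat[of _ 1 1 _ n _ n _ _ 1 _ n]) auto
    ultimately show ?thesis by (simp add: A'blk)
  qed
  define U where "U = W * F"
  have U: "U \<in> carrier_mat (Suc n) (Suc n)" using W F by (simp add: U_def)
  have Ut: "transpose_mat U = transpose_mat F * transpose_mat W"
    unfolding U_def by (rule transpose_mult[OF W F])
  note assoc = assoc_mult_mat[of _ "Suc n" "Suc n" _ "Suc n" _ "Suc n"]
  have "transpose_mat U * U = transpose_mat F * ((transpose_mat W * W) * F)"
    unfolding Ut unfolding U_def using W F by (simp add: assoc)
  hence UtU: "transpose_mat U * U = 1\<^sub>m (Suc n)" using F by (simp add: WtW FtF)
  have DD: "?blk ?E ?D \<in> carrier_mat (Suc n) (Suc n)" by (auto simp: mat_diag_def)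
  have "U * (?blk ?E ?D * transpose_mat U) =
      W * (F * (?blk ?E ?D * transpose_mat F)) * transpose_mat W"
    unfolding Ut unfolding U_def using W F DD by (simp add: assoc)
  also have "\<dots> = (W * transpose_mat W) * A * (W * transpose_mat W)"
    unfolding FDF unfolding A'_def using W A by (simp add: assoc)
  also have "\<dots> = A" using A by (simp add: WWt)
  finally have "A = U * (mat_diag (Suc n) (\<lambda>i. (e # es) ! i) * transpose_mat U)"
    by (simp add: D)
  thus ?case using U UtU es by (intro exI[of _ U] exI[of _ "e # es"]) simp
qed

text \<open>
  The spectral theorem in coordinates: column \<open>k\<close> of \<open>u\<close> is a unit eigenvector for \<open>e k\<close>.  Sums
  over explicit indices are easier to rearrange than matrix products, and the factorisation of the
  characteristic polynomial records the algebraic multiplicities that enter the energy.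
\<close>

lemma real_spectral_decomposition:
  fixes A :: "real mat"
  assumes A: "A \<in> carrier_mat n n" and sym: "transpose_mat A = A"
  obtains u :: "nat \<Rightarrow> nat \<Rightarrow> real" and e :: "nat \<Rightarrow> real"
  where "\<forall>k<n. \<forall>l<n. (\<Sum>i<n. u i k * u i l) = of_bool (k = l)"
    and "\<forall>i<n. \<forall>j<n. (\<Sum>k<n. u i k * u j k) = of_bool (i = j)"
    and "\<forall>i<n. \<forall>j<n. A $$ (i, j) = (\<Sum>k<n. u i k * e k * u j k)"
    and "char_poly A = (\<Prod>k<n. [:- e k, 1:])"
proof -
  obtain U es where U: "U \<in> carrier_mat n n" and UtU: "transpose_mat U * U = 1\<^sub>m n"
    and es: "length es = n"
    and eq: "A = U * (mat_diag n (\<lambda>i. es ! i) * transpose_mat U)"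
    using real_spectral_theorem[OF A sym] by blast
  have UUt: "U * transpose_mat U = 1\<^sub>m n"
    using mat_mult_left_right_inverse[OF _ U UtU] U by simp
  let ?u = "\<lambda>i k. U $$ (i, k)" and ?e = "\<lambda>k. es ! k"
  let ?D = "mat_diag n ?e"
  have 1: "(\<Sum>i<n. ?u i k * ?u i l) = of_bool (k = l)" if "k < n" "l < n" for k l
    using arg_cong[OF UtU, of "\<lambda>M. M $$ (k, l)"] U that
    by (auto simp: scalar_prod_def atLeast0LessThan split: if_splits)
  have 2: "(\<Sum>k<n. ?u i k * ?u j k) = of_bool (i = j)" if "i < n" "j < n" for i j
    using arg_cong[OF UUt, of "\<lambda>M. M $$ (i, j)"] U that
    by (auto simp: scalar_prod_def atLeast0LessThan split: if_splits)
  have 3: "A $$ (i, j) = (\<Sum>k<n. ?u i k * ?e k * ?u j k)" if "i < n" "j < n" for i j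
    using U that unfolding eq
    by (simp add: mat_diag_mult_left[of _ n n] scalar_prod_def atLeast0LessThan mult.assoc)
  have "similar_mat A ?D"
    unfolding similar_mat_def
    by (intro exI[of _ U] exI[of _ "transpose_mat U"] similar_mat_witI[of _ _ n])
       (use U UtU UUt A eq in \<open>auto simp: assoc_mult_mat[of _ n n _ n _ n]\<close>)
  hence "char_poly A = char_poly ?D" by (rule char_poly_similar)
  also have "\<dots> = (\<Prod>a\<leftarrow>diag_mat ?D. [:- a, 1:])"
    by (rule char_poly_upper_triangular[of _ n]) (auto simp: mat_diag_def)
  also have "diag_mat ?D = map ?e [0..<n]"
    by (auto simp: diag_mat_def mat_diag_def)
  also have "(\<Prod>a\<leftarrow>\<dots>. [:- a, 1:]) = (\<Prod>k<n. [:- ?e k, 1:])"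
    using prod.distinct_set_conv_list[of "[0..<n]" "\<lambda>k. [:- ?e k, 1:]"]
    by (simp add: o_def atLeast0LessThan)
  finally have 4: "char_poly A = (\<Prod>k<n. [:- ?e k, 1:])" .
  show ?thesis by (rule that[of ?u ?e]) (use 1 2 3 4 in auto)
qed

lemma energy_eq_sum_abs:
  assumes A: "A \<in> carrier_mat n n" and cp: "char_poly A = (\<Prod>k<n. [:- e k, 1:])"
  shows "energy A = (\<Sum>k<n. \<bar>e k\<bar>)"
proof -
  have ord: "Polynomial.order x (\<Prod>k\<in>I. [:- e k, 1:]) = card {k \<in> I. e k = x}" if "finite I" for I x
    using that
  proof induction
    case (insert i I)
    have "(\<Prod>k\<in>insert i I. [:- e k, 1:]) \<noteq> 0" using insert(1) by (subst prod_zero_iff) auto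
    hence "Polynomial.order x (\<Prod>k\<in>insert i I. [:- e k, 1:]) =
        Polynomial.order x [:- e i, 1:] + Polynomial.order x (\<Prod>k\<in>I. [:- e k, 1:])"
      unfolding prod.insert[OF insert(1,2)] by (rule order_mult)
    moreover have "Polynomial.order x [:- e i, 1:] = of_bool (e i = x)"
      using order_power_n_n[of "e i" 1] by (auto intro!: order_0I)
    moreover have "{k \<in> insert i I. e k = x} =
        (if e i = x then insert i {k \<in> I. e k = x} else {k \<in> I. e k = x})" by auto
    ultimately show ?case using insert by simp
  qed simp
  have "{x. eigenvalue A x} = e ` {..<n}"
    by (auto simp: eigenvalue_root_char_poly[OF A] cp poly_prod)
  hence "energy A = (\<Sum>x\<in>e ` {..<n}. real (card {k \<in> {..<n}. e k = x}) * \<bar>x\<bar>)"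
    unfolding energy_def cp using ord[of "{..<n}"] by simp
  also have "\<dots> = (\<Sum>x\<in>e ` {..<n}. \<Sum>k | k \<in> {..<n} \<and> e k = x. \<bar>e k\<bar>)"
    by (intro sum.cong refl) simp
  also have "\<dots> = (\<Sum>k<n. \<bar>e k\<bar>)" by (subst sum.image_gen[of "{..<n}" _ e]) auto
  finally show ?thesis .
qed

section \<open>Matrices of negative type\<close>

definition quad_form :: "real mat \<Rightarrow> (nat \<Rightarrow> real) \<Rightarrow> real" where
  "quad_form A x = (\<Sum>i<dim_row A. \<Sum>j<dim_row A. x i * A $$ (i, j) * x j)"

text \<open>
  Schoenberg's notion of a metric of negative type, carried over to matrices; symmetry and the
  zero diagonal, which every distance matrix has, are included.
\<close>

definition negative_type :: "real mat \<Rightarrow> bool" where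
  "negative_type A \<longleftrightarrow> (\<exists>n. A \<in> carrier_mat n n \<and>
     (\<forall>i<n. \<forall>j<n. A $$ (i, j) = A $$ (j, i)) \<and> (\<forall>i<n. A $$ (i, i) = 0) \<and>
     (\<forall>x. (\<Sum>i<n. x i) = 0 \<longrightarrow> quad_form A x \<le> 0))"

text \<open>
  The three claims say that \<open>energy A / 2\<close> is the largest eigenvalue \<open>e m\<close> of \<open>A\<close>.  Two eigenvectors
  for positive eigenvalues would span a plane on which the form is positive definite, but every
  plane contains a nonzero vector with coordinate sum zero, where negative type forbids this.  So
  at most one eigenvalue is positive.  The trace is zero, so the positive eigenvalue \<open>e m\<close>
  balances all the others, and the sum of absolute values is \<open>2 * e m\<close>.  (If no eigenvalue is
  positive, then all of them are zero and the argument still applies.)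
\<close>

lemma negative_type_energy:
  assumes A: "A \<in> carrier_mat n n" and n: "n > 0" and neg: "negative_type A"
  shows energy_rayleigh_le: "\<And>x. quad_form A x \<le> energy A / 2 * (\<Sum>i<n. (x i)\<^sup>2)"
    and energy_rayleigh_eigenvector: 
      "\<And>x i. quad_form A x = energy A / 2 * (\<Sum>i<n. (x i)\<^sup>2) \<Longrightarrow> i < n \<Longrightarrow>
         (\<Sum>j<n. A $$ (i, j) * x j) = energy A / 2 * x i"
    and energy_rayleigh_attained: 
      "\<exists>x. (\<Sum>i<n. (x i)\<^sup>2) = 1 \<and> quad_form A x = energy A / 2"
proof -
  have dim: "dim_row A = n" using A by simp
  have symA: "A $$ (i, j) = A $$ (j, i)" and diag: "A $$ (i, i) = 0"
    if "i < n" "j < n" for i j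
    using neg dim that unfolding negative_type_def by auto
  have cnd: "quad_form A x \<le> 0" if "(\<Sum>i<n. x i) = 0" for x
    using neg dim that unfolding negative_type_def by auto
  have sym: "transpose_mat A = A" using A symA by (intro eq_matI) auto
  obtain u e where spec: "\<forall>k<n. \<forall>l<n. (\<Sum>i<n. u i k * u i l) = of_bool (k = l)"
      "\<forall>i<n. \<forall>j<n. (\<Sum>k<n. u i k * u j k) = of_bool (i = j)"
      "\<forall>i<n. \<forall>j<n. A $$ (i, j) = (\<Sum>k<n. u i k * e k * u j k)"
    and cp: "char_poly A = (\<Prod>k<n. [:- e k, 1:])"
    using real_spectral_decomposition[OF A sym] .
  have ortho: "(\<Sum>i<n. u i k * u i l) = of_bool (k = l)" if "k < n" "l < n" for k l
    using spec(1) that by blast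
  have ortho': "(\<Sum>k<n. u i k * u j k) = of_bool (i = j)" if "i < n" "j < n" for i j
    using spec(2) that by blast
  have Aeq: "A $$ (i, j) = (\<Sum>k<n. u i k * e k * u j k)" if "i < n" "j < n" for i j
    using spec(3) that by blast
  \<comment> \<open>Coordinates with respect to the eigenbasis.\<close>
  define c where "c x k = (\<Sum>i<n. u i k * x i)" for x :: "nat \<Rightarrow> real" and k
  have expand: "x i = (\<Sum>k<n. u i k * c x k)" if "i < n" for x i
  proof -
    have "(\<Sum>k<n. u i k * c x k) = (\<Sum>k<n. \<Sum>j<n. u i k * u j k * x j)"
      by (simp add: c_def sum_distrib_left mult.assoc)
    also have "\<dots> = (\<Sum>j<n. (\<Sum>k<n. u i k * u j k) * x j)"
      by (subst sum.swap) (simp add: sum_distrib_right)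
    also have "\<dots> = (\<Sum>j<n. if i = j then x j else 0)"
      by (intro sum.cong refl) (use that in \<open>auto simp: ortho'\<close>)
    finally show ?thesis using that by simp
  qed
  have Ax: "(\<Sum>j<n. A $$ (i, j) * x j) = (\<Sum>k<n. u i k * (e k * c x k))" if "i < n" for x i
  proof -
    have "(\<Sum>j<n. A $$ (i, j) * x j) = (\<Sum>j<n. \<Sum>k<n. u i k * e k * u j k * x j)"
      by (intro sum.cong refl) (use that in \<open>simp add: Aeq sum_distrib_right\<close>)
    also have "\<dots> = (\<Sum>k<n. u i k * (e k * c x k))"
      by (subst sum.swap) (simp add: c_def sum_distrib_left mult.assoc)
    finally show ?thesis .
  qed
  have parseval: "(\<Sum>i<n. x i * (\<Sum>k<n. u i k * f k)) = (\<Sum>k<n. c x k * f k)" for x f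
    by (simp add: sum_distrib_left, subst sum.swap)
       (simp add: c_def sum_distrib_left sum_distrib_right mult_ac)
  have norm: "(\<Sum>i<n. (x i)\<^sup>2) = (\<Sum>k<n. (c x k)\<^sup>2)" for x
  proof -
    have "(\<Sum>i<n. (x i)\<^sup>2) = (\<Sum>i<n. x i * (\<Sum>k<n. u i k * c x k))"
      by (intro sum.cong refl) (use expand in \<open>auto simp: power2_eq_square\<close>)
    thus ?thesis by (simp add: parseval power2_eq_square)
  qed
  have qf: "quad_form A x = (\<Sum>k<n. e k * (c x k)\<^sup>2)" for x
  proof -
    have "quad_form A x = (\<Sum>i<n. x i * (\<Sum>j<n. A $$ (i, j) * x j))"
      by (simp add: quad_form_def dim sum_distrib_left mult.assoc)
    also have "\<dots> = (\<Sum>i<n. x i * (\<Sum>k<n. u i k * (e k * c x k)))"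
      by (intro sum.cong refl) (simp add: Ax)
    also have "\<dots> = (\<Sum>k<n. e k * (c x k)\<^sup>2)"
      unfolding parseval by (simp add: power2_eq_square mult_ac)
    finally show ?thesis .
  qed
  have trace: "(\<Sum>k<n. e k) = 0"
  proof -
    have "(\<Sum>k<n. e k) = (\<Sum>k<n. e k * (\<Sum>i<n. u i k * u i k))"
      by (simp add: ortho)
    also have "\<dots> = (\<Sum>i<n. \<Sum>k<n. u i k * e k * u i k)"
      by (simp add: sum_distrib_left, subst sum.swap) (simp add: algebra_simps)
    also have "\<dots> = (\<Sum>i<n. A $$ (i, i))"
      by (intro sum.cong refl) (simp add: Aeq)
    finally show ?thesis by (simp add: diag)
  qed
  have unique_pos: "e l \<le> 0" if kl: "k < n" "l < n" "k \<noteq> l" "e k > 0" for k l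
  proof (rule ccontr)
    assume "\<not> e l \<le> 0"
    hence l: "e l > 0" by simp
    define s where "s k = (\<Sum>i<n. u i k)" for k
    \<comment> \<open>A combination of the two eigenvectors with coordinate sum zero.\<close>
    obtain a b :: real where ab: "a * s k + b * s l = 0" "a \<noteq> 0 \<or> b \<noteq> 0"
    proof (cases "s k = 0")
      case True
      thus ?thesis using that[of 1 0] by simp
    next
      case False
      thus ?thesis using that[of "s l" "- s k"] by (simp add: mult.commute)
    qed
    define x where "x i = a * u i k + b * u i l" for i
    have cx: "c x m = a * of_bool (m = k) + b * of_bool (m = l)" if "m < n" for m
      using ortho[OF that kl(1)] ortho[OF that kl(2)]
      by (simp add: c_def x_def algebra_simps sum.distrib flip: sum_distrib_left)
    have "(\<Sum>i<n. x i) = 0"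
      using ab(1) by (simp add: x_def s_def sum.distrib sum_distrib_left)
    hence "quad_form A x \<le> 0" by (rule cnd)
    moreover have "quad_form A x = (\<Sum>m\<in>{k, l}. e m * (c x m)\<^sup>2)"
      unfolding qf by (rule sum.mono_neutral_right) (use kl in \<open>auto simp: cx\<close>)
    hence "quad_form A x = e k * a\<^sup>2 + e l * b\<^sup>2"
      using kl by (simp add: cx)
    moreover have "e k * a\<^sup>2 + e l * b\<^sup>2 > 0"
      using ab(2) kl(4) l by (auto intro: add_pos_nonneg add_nonneg_pos)
    ultimately show False by simp
  qed
  have "\<exists>m\<in>{..<n}. \<forall>k\<in>{..<n}. e k \<le> e m"
  proof -
    have "Max (e ` {..<n}) \<in> e ` {..<n}" using n by (intro Max_in) auto
    thus ?thesis by (metis (mono_tags) Max_ge finite_imageI finite_lessThan imageE imageI)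
  qed
  then obtain m where m: "m < n" "\<And>k. k < n \<Longrightarrow> e k \<le> e m" by auto
  have m0: "e m \<ge> 0"
  proof -
    have "(\<Sum>k<n. e k) \<le> real n * e m"
      using sum_bounded_above[of "{..<n}" e "e m"] m(2) by simp
    thus ?thesis using trace n by (simp add: zero_le_mult_iff)
  qed
  have others: "e k \<le> 0" if "k < n" "k \<noteq> m" for k
  proof (rule ccontr)
    assume "\<not> e k \<le> 0"
    thus False using unique_pos[of k m] m that m0 by fastforce
  qed
  have "energy A = (\<Sum>k<n. \<bar>e k\<bar>)" by (rule energy_eq_sum_abs[OF A cp])
  also have "\<dots> = e m + (\<Sum>k\<in>{..<n} - {m}. - e k)"
    using m(1) m0 others by (subst sum.remove[of _ m]) (auto intro!: sum.cong)
  also have "(\<Sum>k\<in>{..<n} - {m}. - e k) = e m"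
    using trace m(1) by (subst (asm) sum.remove[of _ m]) (auto simp: sum_negf)
  finally have E: "energy A / 2 = e m" by simp
  show "quad_form A x \<le> energy A / 2 * (\<Sum>i<n. (x i)\<^sup>2)" for x
    unfolding qf E norm[of x] sum_distrib_left by (intro sum_mono mult_right_mono m) auto
  show "(\<Sum>j<n. A $$ (i, j) * x j) = energy A / 2 * x i"
    if eq: "quad_form A x = energy A / 2 * (\<Sum>i<n. (x i)\<^sup>2)" and i: "i < n" for x i
  proof -
    \<comment> \<open>All summands are nonnegative, so \<open>x\<close> has no component outside the top eigenspace.\<close>
    have "(\<Sum>k<n. (e m - e k) * (c x k)\<^sup>2) = 0"
      using eq unfolding qf E norm[of x] by (simp add: sum_distrib_left left_diff_distrib sum_subtractf)
    hence z: "(e m - e k) * (c x k)\<^sup>2 = 0" if "k < n" for k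
      using that m(2) by (subst (asm) sum_nonneg_eq_0_iff) auto
    have ek: "e k * c x k = e m * c x k" if "k < n" for k
      using z[OF that] by auto
    have "(\<Sum>k<n. u i k * (e k * c x k)) = (\<Sum>k<n. u i k * (e m * c x k))"
      by (intro sum.cong refl) (simp add: ek)
    also have "\<dots> = e m * (\<Sum>k<n. u i k * c x k)"
      by (simp add: sum_distrib_left algebra_simps)
    finally show ?thesis using i expand[OF i, of x] by (simp add: Ax E)
  qed
  show "\<exists>x. (\<Sum>i<n. (x i)\<^sup>2) = 1 \<and> quad_form A x = energy A / 2"
  proof (intro exI conjI)
    let ?x = "\<lambda>i. u i m"
    show "(\<Sum>i<n. (?x i)\<^sup>2) = 1" using ortho[of m m] m by (simp add: power2_eq_square)
    have "quad_form A ?x = (\<Sum>k<n. if k = m then e k else 0)"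
      unfolding qf by (intro sum.cong refl) (use m in \<open>auto simp: c_def ortho\<close>)
    thus "quad_form A ?x = energy A / 2" using m by (simp add: E)
  qed
qed

text \<open>
  Perron's argument.  Replacing a top unit eigenvector \<open>v\<close> of \<open>A\<close> by its entrywise absolute value
  \<open>w\<close> does not decrease the form of \<open>A\<close>, passing from \<open>A\<close> to \<open>B\<close> does not decrease it at \<open>w\<close>, and
  the largest eigenvalue of \<open>B\<close> bounds the result.  If the two energies agree, then \<open>w\<close> is an
  eigenvector of \<open>B\<close>; positivity off the diagonal makes all entries of \<open>w\<close> positive, so the
  forms of \<open>A\<close> and \<open>B\<close> can only agree at \<open>w\<close> if all entries of the matrices do.
\<close>

lemma energy_mono_negative_type:
  assumes A: "A \<in> carrier_mat n n" and B: "B \<in> carrier_mat n n" and n: "n > 0"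
    and negA: "negative_type A" and negB: "negative_type B"
    and nonneg: "\<And>i j. i < n \<Longrightarrow> j < n \<Longrightarrow> 0 \<le> A $$ (i, j)"
    and le: "\<And>i j. i < n \<Longrightarrow> j < n \<Longrightarrow> A $$ (i, j) \<le> B $$ (i, j)"
  shows "energy A \<le> energy B"
    and "(\<And>i j. i < n \<Longrightarrow> j < n \<Longrightarrow> i \<noteq> j \<Longrightarrow> 0 < B $$ (i, j)) \<Longrightarrow>
      energy A = energy B \<Longrightarrow> A = B"
proof -
  obtain v where v: "(\<Sum>i<n. (v i)\<^sup>2) = 1" "quad_form A v = energy A / 2"
    using energy_rayleigh_attained[OF A n negA] by auto
  define w where "w i = \<bar>v i\<bar>" for i
  have w0: "w i \<ge> 0" for i by (simp add: w_def)
  have w1: "(\<Sum>i<n. (w i)\<^sup>2) = 1" using v by (simp add: w_def)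
  have Aw: "quad_form A v \<le> quad_form A w"
    unfolding quad_form_def w_def
  proof (intro sum_mono)
    fix i j assume "i \<in> {..<dim_row A}" "j \<in> {..<dim_row A}"
    hence "v i * A $$ (i, j) * v j \<le> \<bar>v i * A $$ (i, j) * v j\<bar>" by simp
    also have "\<dots> = \<bar>v i\<bar> * A $$ (i, j) * \<bar>v j\<bar>"
      using nonneg[of i j] A \<open>i \<in> _\<close> \<open>j \<in> _\<close> by (simp add: abs_mult)
    finally show "v i * A $$ (i, j) * v j \<le> \<bar>v i\<bar> * A $$ (i, j) * \<bar>v j\<bar>" .
  qed
  have diff: "quad_form B w - quad_form A w =
      (\<Sum>i<n. \<Sum>j<n. w i * (B $$ (i, j) - A $$ (i, j)) * w j)"
    using A B by (simp add: quad_form_def algebra_simps sum_subtractf)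
  have term0: "w i * (B $$ (i, j) - A $$ (i, j)) * w j \<ge> 0" if "i < n" "j < n" for i j
    using le[OF that] w0 by simp
  have AB: "quad_form A w \<le> quad_form B w"
    using diff term0 by (smt (verit) lessThan_iff sum_nonneg)
  have Bw: "quad_form B w \<le> energy B / 2"
    using energy_rayleigh_le[OF B n negB, of w] by (simp add: w1)
  show "energy A \<le> energy B" using v(2) Aw AB Bw by simp
  assume pos: "\<And>i j. i < n \<Longrightarrow> j < n \<Longrightarrow> i \<noteq> j \<Longrightarrow> 0 < B $$ (i, j)"
    and eq: "energy A = energy B"
  have eqB: "quad_form B w = energy B / 2" and eqA: "quad_form A w = quad_form B w"
    using v(2) Aw AB Bw eq by simp_all
  have eig: "(\<Sum>j<n. B $$ (i, j) * w j) = energy B / 2 * w i" if "i < n" for i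
    using energy_rayleigh_eigenvector[OF B n negB, of w i] that by (simp add: w1 eqB)
  have "\<exists>i<n. w i \<noteq> 0"
  proof (rule ccontr)
    assume "\<not> ?thesis"
    hence "(\<Sum>i<n. (w i)\<^sup>2) = 0" by simp
    thus False using w1 by simp
  qed
  then obtain i0 where i0: "i0 < n" "w i0 \<noteq> 0" by auto
  have wpos: "w i > 0" if "i < n" for i
  proof (rule ccontr)
    assume "\<not> w i > 0"
    hence wi: "w i = 0" using w0[of i] by simp
    \<comment> \<open>Row \<open>i\<close> of the eigenvector equation: the left side sees the positive entry \<open>w i0\<close>.\<close>
    have "0 < (\<Sum>j<n. B $$ (i, j) * w j)"
    proof (rule sum_pos2[of _ i0])
      show "0 < B $$ (i, i0) * w i0"
        using pos[OF that i0(1)] i0 wi w0[of i0] by (intro mult_pos_pos) auto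
      show "0 \<le> B $$ (i, j) * w j" if "j \<in> {..<n}" for j
        using nonneg[of i j] le[of i j] w0[of j] \<open>i < n\<close> that by simp
    qed (use i0 in auto)
    thus False using eig[OF that] wi by simp
  qed
  have "(\<Sum>i<n. \<Sum>j<n. w i * (B $$ (i, j) - A $$ (i, j)) * w j) = 0"
    using diff eqA by simp
  hence "(\<Sum>j<n. w i * (B $$ (i, j) - A $$ (i, j)) * w j) = 0" if "i < n" for i
    using that term0 by (subst (asm) sum_nonneg_eq_0_iff) (auto intro!: sum_nonneg)
  hence "w i * (B $$ (i, j) - A $$ (i, j)) * w j = 0" if "i < n" "j < n" for i j
    using that term0 by (metis (no_types, lifting) finite_lessThan lessThan_iff sum_nonneg_eq_0_iff)
  hence "B $$ (i, j) = A $$ (i, j)" if "i < n" "j < n" for i j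
    using that wpos[of i] wpos[of j] by fastforce
  thus "A = B" using A B by (intro eq_matI) auto
qed

section \<open>Distances on a line\<close>

text \<open>
  The distance of two points on a line is the number of thresholds \<open>t\<close> that separate them.
\<close>

lemma abs_diff_eq_sum_cuts:
  fixes a b N :: nat
  assumes "a \<le> N" "b \<le> N"
  shows "\<bar>real a - real b\<bar> = (\<Sum>t<N. (of_bool (t < a) - of_bool (t < b))\<^sup>2)"
proof -
  have "(\<Sum>t<M. (of_bool (t < a) - of_bool (t < b))\<^sup>2) = \<bar>real (min a M) - real (min b M)\<bar>" for M
  proof (induction M)
    case (Suc M)
    thus ?case by (cases "M < a"; cases "M < b") (auto simp: min_def)
  qed simp
  from this[of N] show ?thesis using assms by simp
qed

text \<open>
  For a single threshold with indicator \<open>c\<close>, the identity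
  \<open>(c i - c j)\<^sup>2 = c i + c j - 2 * c i * c j\<close> and the vanishing coordinate sum leave only
  \<open>- 2 * (\<Sum>i. c i * x i)\<^sup>2\<close>.  The line metric is a sum of such terms.
\<close>

lemma line_distances_negative_type:
  fixes l :: "nat \<Rightarrow> nat" and x :: "nat \<Rightarrow> real"
  assumes x: "(\<Sum>i<n. x i) = 0"
  shows "(\<Sum>i<n. \<Sum>j<n. x i * \<bar>real (l i) - real (l j)\<bar> * x j) \<le> 0"
proof -
  define N where "N = (\<Sum>i<n. l i)"
  have le: "l i \<le> N" if "i < n" for i
    unfolding N_def using that by (intro member_le_sum) auto
  define c :: "nat \<Rightarrow> nat \<Rightarrow> real" where "c t i = of_bool (t < l i)" for t i
  have sq: "(c t i)\<^sup>2 = c t i" for t i by (simp add: c_def)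
  have cut: "(\<Sum>i<n. \<Sum>j<n. x i * (c t i - c t j)\<^sup>2 * x j) = - 2 * (\<Sum>i<n. c t i * x i)\<^sup>2" for t
  proof -
    have "(\<Sum>i<n. \<Sum>j<n. x i * (c t i - c t j)\<^sup>2 * x j) =
       (\<Sum>i<n. \<Sum>j<n. (c t i * x i) * x j + x i * (c t j * x j) - 2 * ((c t i * x i) * (c t j * x j)))"
      by (intro sum.cong refl) (simp add: power2_diff sq algebra_simps)
    also have "\<dots> = (\<Sum>i<n. c t i * x i) * (\<Sum>i<n. x i) + (\<Sum>i<n. x i) * (\<Sum>i<n. c t i * x i)
        - 2 * ((\<Sum>i<n. c t i * x i) * (\<Sum>i<n. c t i * x i))"
      by (simp add: sum.distrib sum_subtractf sum_product flip: sum_distrib_left)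
    finally show ?thesis by (simp add: x power2_eq_square)
  qed
  have "(\<Sum>i<n. \<Sum>j<n. x i * \<bar>real (l i) - real (l j)\<bar> * x j) =
      (\<Sum>i<n. \<Sum>j<n. \<Sum>t<N. x i * (c t i - c t j)\<^sup>2 * x j)"
    by (intro sum.cong refl)
       (simp add: abs_diff_eq_sum_cuts[OF le le] c_def sum_distrib_left sum_distrib_right)
  also have "\<dots> = (\<Sum>i<n. \<Sum>t<N. \<Sum>j<n. x i * (c t i - c t j)\<^sup>2 * x j)"
    by (intro sum.cong refl sum.swap)
  also have "\<dots> = (\<Sum>t<N. \<Sum>i<n. \<Sum>j<n. x i * (c t i - c t j)\<^sup>2 * x j)"
    by (rule sum.swap)
  also have "\<dots> \<le> 0"
    unfolding cut by (intro sum_nonpos) simp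
  finally show ?thesis .
qed

text \<open>
  Consecutive entries differ by at most one: a larger jump would skip a value, which then could
  stand neither before nor after the jump.
\<close>

lemma sorted_downward_closed_gap:
  fixes xs :: "nat list"
  assumes "sorted xs" and down: "\<And>k. Suc k \<in> set xs \<Longrightarrow> k \<in> set xs"
    and "i \<le> j" "j < length xs"
  shows "xs ! j \<le> xs ! i + (j - i)"
  using assms(3,4)
proof (induction j rule: dec_induct)
  case (step j)
  have "xs ! Suc j \<le> Suc (xs ! j)"
  proof (rule ccontr)
    assume gap: "\<not> ?thesis"
    have below: "k \<in> set xs" if "k \<le> xs ! Suc j" for k
      using that by (induction k rule: inc_induct) (use step.prems in \<open>auto intro: down\<close>)
    obtain m where m: "m < length xs" "xs ! m = Suc (xs ! j)"
      using below[of "Suc (xs ! j)"] gap by (auto simp: in_set_conv_nth)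
    show False
    proof (cases "m \<le> j")
      case True
      thus False using sorted_nth_mono[OF \<open>sorted xs\<close>, of m j] m step.prems by simp
    next
      case False
      thus False using sorted_nth_mono[OF \<open>sorted xs\<close>, of "Suc j" m] m gap by simp
    qed
  qed
  thus ?case using step by simp
qed simp

section \<open>Levels in rooted graphs\<close>

context pair_wf_digraph
begin

lemma level_le_length: "awalk r p v \<Longrightarrow> level G r v \<le> length p"
  unfolding level_def by (intro Least_le) blast

lemma shortest_awalk_exists:
  assumes "awalk r q v"
  obtains p where "awalk r p v" "length p = level G r v"
proof -
  have "\<exists>k p. awalk r p v \<and> length p = k" using assms by blast
  hence "\<exists>p. awalk r p v \<and> length p = level G r v"
    unfolding level_def by (rule LeastI_ex)
  thus ?thesis using that by blast
qed

lemma level_root: "r \<in> pverts G \<Longrightarrow> level G r r = 0"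
  using level_le_length[of r "[]" r] by (simp add: awalk_Nil_iff)

lemma level_arc_le:
  assumes "awalk r q u" "(u, v) \<in> parcs G"
  shows "level G r v \<le> Suc (level G r u)"
proof -
  obtain p where p: "awalk r p u" "length p = level G r u"
    using shortest_awalk_exists[OF assms(1)] .
  have "awalk r (p @ [(u, v)]) v"
    using p(1) assms(2) by (intro awalk_appendI[of r p u]) (auto simp: awalk_simps in_arcsD2)
  from level_le_length[OF this] show ?thesis using p(2) by simp
qed

lemma level_predecessor:
  assumes "awalk r q v" "level G r v = Suc k"
  shows "\<exists>u. (u, v) \<in> parcs G \<and> level G r u = k"
proof -
  obtain p where p: "awalk r p v" "length p = Suc k"
    using shortest_awalk_exists[OF assms(1)] assms(2) by metis
  then obtain p' a where pa: "p = p' @ [a]" by (cases p rule: rev_cases) auto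
  obtain u w where a: "a = (u, w)" by (cases a)
  have "awalk r p' (fst a)" "w = v" "a \<in> parcs G"
    using p(1) unfolding pa a by (auto simp: awalk_simps)
  hence u: "awalk r p' u" "(u, v) \<in> parcs G" by (auto simp: a)
  have "level G r u \<le> k" using level_le_length[OF u(1)] p(2) pa by simp
  moreover have "Suc k \<le> Suc (level G r u)" using level_arc_le[OF u] assms(2) by simp
  ultimately show ?thesis using u by (intro exI[of _ u]) simp
qed

end

text \<open>
  An isomorphism and its inverse carry walks to walks of the same length.
\<close>

lemma level_rooted_iso:
  assumes wf: "pair_wf_digraph G" and hom: "pre_digraph.digraph_isomorphism (with_proj G) f"
    and H: "with_proj H = app_iso f (with_proj G)"
    and rv: "r \<in> pverts G" "v \<in> pverts G"
  shows "level H (iso_verts f r) (iso_verts f v) = level G r v"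
proof -
  interpret pair_wf_digraph G by fact
  have "(\<exists>p. pre_digraph.awalk (with_proj H) (iso_verts f r) p (iso_verts f v) \<and> length p = k) \<longleftrightarrow>
      (\<exists>p. awalk r p v \<and> length p = k)" for k
  proof
    assume "\<exists>p. pre_digraph.awalk (with_proj H) (iso_verts f r) p (iso_verts f v) \<and> length p = k"
    then obtain p where p: "pre_digraph.awalk (app_iso f (with_proj G)) (iso_verts f r) p (iso_verts f v)"
      and "length p = k" by (auto simp: H)
    moreover have "awalk r (map (iso_arcs (inv_iso f)) p) v"
      using awalk_app_isoD[OF p hom] iso_verts_inv_iso[OF hom] rv by simp
    ultimately show "\<exists>p. awalk r p v \<and> length p = k" by (metis length_map)
  next
    assume "\<exists>p. awalk r p v \<and> length p = k"
    thus "\<exists>p. pre_digraph.awalk (with_proj H) (iso_verts f r) p (iso_verts f v) \<and> length p = k"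
      using awalk_app_isoI[OF _ hom] by (metis H length_map)
  qed
  thus ?thesis unfolding level_def by presburger
qed

lemma pair_wf_digraph_rooted_path: "pair_wf_digraph (rooted_path n)"
  by unfold_locales (auto simp: rooted_path_def)

lemma level_rooted_path:
  assumes "i < n"
  shows "level (rooted_path n) 0 i = i"
proof -
  interpret pair_wf_digraph "rooted_path n" by (rule pair_wf_digraph_rooted_path)
  have "\<exists>p. awalk 0 p i \<and> length p = i" if "i < n" for i
    using that
  proof (induction i)
    case 0
    hence "0 \<in> pverts (rooted_path n)" by (simp add: rooted_path_def)
    thus ?case by (intro exI[of _ "[]"]) (simp add: awalk_simps)
  next
    case (Suc i)
    then obtain p where "awalk 0 p i" "length p = i" by auto
    moreover have "(i, Suc i) \<in> parcs (rooted_path n)" using Suc.prems by (simp add: rooted_path_def)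
    ultimately show ?case
      by (intro exI[of _ "p @ [(i, Suc i)]"] conjI awalk_appendI[of 0 p i])
         (auto simp: awalk_simps in_arcsD2)
  qed
  then obtain p where p: "awalk 0 p i" "length p = i" using assms by blast
  have "v \<le> u + length q" if "awalk u q v" for u q v
    using that
  proof (induction q arbitrary: u)
    case (Cons a q)
    hence "a \<in> parcs (rooted_path n)" "fst a = u" "v \<le> snd a + length q"
      by (auto simp: awalk_simps)
    moreover from this(1) have "snd a \<le> Suc (fst a)" by (auto simp: rooted_path_def)
    ultimately show ?case by simp
  qed (simp add: awalk_simps)
  hence "i \<le> level (rooted_path n) 0 i"
    using shortest_awalk_exists[OF p(1)] by (metis add_0)
  thus ?thesis using level_le_length[OF p(1)] p(2) by simp
qed

lemma rooted_tree_awalk_exists: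
  assumes "rooted_tree T r" "v \<in> pverts T"
  shows "\<exists>p. pre_digraph.awalk (with_proj T) r p v"
proof -
  interpret pair_graph T using assms(1) by (simp add: rooted_tree_def)
  have "strongly_connected (with_proj T)"
    using assms(1) pair_sym_arcs symmetric_connected_imp_strongly_connected
    by (simp add: rooted_tree_def)
  hence "r \<rightarrow>\<^sup>*\<^bsub>with_proj T\<^esub> v"
    using assms by (auto simp: strongly_connected_def rooted_tree_def)
  thus ?thesis by (simp add: reachable_awalk)
qed

text \<open>
  The last but one vertex of a shortest walk from the root lies one level lower.
\<close>

lemma rooted_tree_levels_downward_closed:
  assumes T: "rooted_tree T r" and k: "Suc k \<in> level T r ` pverts T"
  shows "k \<in> level T r ` pverts T"
proof -
  interpret pair_graph T using T by (simp add: rooted_tree_def)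
  obtain v where v: "v \<in> pverts T" "level T r v = Suc k" using k by auto
  obtain p where "awalk r p v" using rooted_tree_awalk_exists[OF T v(1)] by auto
  then obtain u where "(u, v) \<in> parcs T" "level T r u = k"
    using level_predecessor[OF _ v(2)] by auto
  thus ?thesis using in_arcsD1 by blast
qed

text \<open>
  The level function is itself the isomorphism.  An edge joins vertices whose levels differ by at
  most one, and the levels are distinct, so every edge becomes an edge of the path.  Conversely,
  the vertex at level \<open>i + 1\<close> has a neighbour at level \<open>i\<close>, and only one vertex has that level.
\<close>

lemma rooted_iso_path_of_bij_levels:
  assumes T: "rooted_tree T r" and bij: "bij_betw (level T r) (pverts T) {..<n}"
  shows "rooted_iso T r (rooted_path n) 0"
proof -
  interpret pair_graph T using T by (simp add: rooted_tree_def)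
  let ?l = "level T r"
  define f where "f = \<lparr>iso_verts = ?l, iso_arcs = map_prod ?l ?l, iso_head = snd, iso_tail = fst\<rparr>"
  have inj: "inj_on ?l (pverts T)" and img: "?l ` pverts T = {..<n}"
    using bij by (auto simp: bij_betw_def)
  have hom: "digraph_isomorphism f"
    unfolding digraph_isomorphism_def
  proof (intro conjI)
    show "wf_digraph (with_proj T)" by unfold_locales
    show "inj_on (iso_arcs f) (parcs T)"
      using inj in_arcsD1 in_arcsD2
      by (auto simp: inj_on_def f_def) 
  qed (use inj in \<open>auto simp: f_def\<close>)
  have adjacent: "?l v = Suc (?l u) \<or> ?l u = Suc (?l v)" if uv: "(u, v) \<in> parcs T" for u v
  proof -
    have vu: "(v, u) \<in> parcs T" using uv pair_sym_arcs by (auto simp: symmetric_def sym_def)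
    have in_verts: "u \<in> pverts T" "v \<in> pverts T" using uv in_arcsD1 in_arcsD2 by auto
    have "u \<noteq> v" using pair_no_loops[OF uv] by simp
    hence "?l u \<noteq> ?l v" using inj in_verts by (auto dest: inj_onD)
    moreover obtain p q where "awalk r p u" "awalk r q v"
      using rooted_tree_awalk_exists[OF T] in_verts by blast
    hence "?l v \<le> Suc (?l u)" "?l u \<le> Suc (?l v)"
      using level_arc_le uv vu by auto
    ultimately show ?thesis by linarith
  qed
  have consecutive: "(i, Suc i) \<in> map_prod ?l ?l ` parcs T" if i: "Suc i < n" for i
  proof -
    have "Suc i \<in> ?l ` pverts T" using i by (simp add: img)
    then obtain v where v: "v \<in> pverts T" "?l v = Suc i" by auto
    obtain p where "awalk r p v" using rooted_tree_awalk_exists[OF T v(1)] by auto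
    then obtain u where "(u, v) \<in> parcs T" "?l u = i"
      using level_predecessor[OF _ v(2)] by auto
    thus ?thesis using v(2) by (intro image_eqI[of _ _ "(u, v)"]) auto
  qed
  have consecutive': "(Suc i, i) \<in> map_prod ?l ?l ` parcs T" if i: "Suc i < n" for i
  proof -
    obtain u v where uv: "(u, v) \<in> parcs T" "?l u = i" "?l v = Suc i"
      using consecutive[OF i] by auto
    have "(v, u) \<in> parcs T" using uv(1) pair_sym_arcs by (auto simp: symmetric_def sym_def)
    thus ?thesis using uv by (intro image_eqI[of _ _ "(v, u)"]) auto
  qed
  have "map_prod ?l ?l ` parcs T = parcs (rooted_path n)"
  proof (intro equalityI subsetI)
    fix a assume "a \<in> map_prod ?l ?l ` parcs T"
    then obtain u v where a: "a = (?l u, ?l v)" and uv: "(u, v) \<in> parcs T" by auto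
    have "?l u < n" "?l v < n" using img in_arcsD1[OF uv] in_arcsD2[OF uv] by auto
    thus "a \<in> parcs (rooted_path n)" using adjacent[OF uv] by (simp add: a rooted_path_def)
  next
    fix a assume "a \<in> parcs (rooted_path n)"
    thus "a \<in> map_prod ?l ?l ` parcs T"
      using consecutive consecutive' by (auto simp: rooted_path_def)
  qed
  hence "with_proj (rooted_path n) = app_iso f (with_proj T)"
    using img by (simp add: app_iso_def with_proj_def f_def) (simp add: rooted_path_def)
  moreover have "iso_verts f r = 0"
    using T level_root by (simp add: f_def rooted_tree_def)
  ultimately show ?thesis unfolding rooted_iso_def using hom by blast
qed

section \<open>Level matrices and the extremal tree\<close>

lemma level_matrix_carrier: "level_matrix T r vs \<in> carrier_mat (length vs) (length vs)"
  by (simp add: level_matrix_def)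

lemma level_matrix_negative_type: "negative_type (level_matrix T r vs)"
  unfolding negative_type_def
proof (intro exI[of _ "length vs"] conjI allI impI)
  fix x :: "nat \<Rightarrow> real"
  assume "(\<Sum>i<length vs. x i) = 0"
  from line_distances_negative_type[OF this, of "\<lambda>i. level T r (vs ! i)"]
  show "quad_form (level_matrix T r vs) x \<le> 0"
    by (simp add: quad_form_def level_matrix_def)
qed (simp_all add: level_matrix_def)

lemma level_energy_rooted_iso:
  assumes T: "rooted_tree T r" and iso: "rooted_iso T r H s"
  shows "level_energy T r = level_energy H s"
proof -
  interpret pair_graph T using T by (simp add: rooted_tree_def)
  obtain f where hom: "digraph_isomorphism f" and H: "with_proj H = app_iso f (with_proj T)"
    and s: "iso_verts f r = s"
    using iso by (auto simp: rooted_iso_def)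
  obtain vs where vs: "set vs = pverts T" "distinct vs"
    using finite_distinct_list[OF pair_finite_verts] by blast
  have "pverts H = iso_verts f ` pverts T"
    using H by (metis verts_app_iso with_proj_simps(1))
  moreover have "inj_on (iso_verts f) (pverts T)"
    using hom by (simp add: digraph_isomorphism_def)
  ultimately have ws: "distinct (map (iso_verts f) vs)" "set (map (iso_verts f) vs) = pverts H"
    using vs by (simp_all add: distinct_map)
  have lev: "level H s (iso_verts f v) = level T r v" if "v \<in> set vs" for v
    using level_rooted_iso[OF pair_wf_digraph_axioms hom H, of r v] T that vs
    by (simp add: s rooted_tree_def)
  have "level_matrix H s (map (iso_verts f) vs) = level_matrix T r vs"
    by (intro eq_matI) (simp_all add: level_matrix_def lev)
  thus ?thesis using level_energy_eq[OF vs(2,1)] level_energy_eq[OF ws] by simp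
qed

text \<open>
  The vertices of \<open>T\<close> are listed by increasing level and those of the path from \<open>0\<close> to \<open>n - 1\<close>;
  with these orders the level matrix of \<open>T\<close> is entrywise at most that of the path.  If the matrices
  coincide, distinct vertices have distinct levels, and the distance of a level from that of the
  root is at most \<open>n - 1\<close>.
\<close>

theorem theorem14:
  fixes T :: "'a pair_pre_digraph" and r :: 'a and n :: nat
  assumes "n \<ge> 1"
    and "rooted_tree T r" and "card (pverts T) = n"
  shows "level_energy T r \<le> level_energy (rooted_path n) 0 \<and>
    (level_energy T r = level_energy (rooted_path n) 0 \<longleftrightarrow>
     rooted_iso T r (rooted_path n) 0)"
proof -
  interpret pair_graph T using assms(2) by (simp add: rooted_tree_def)
  let ?l = "level T r"
  obtain ws where ws: "set ws = pverts T" "distinct ws"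
    using finite_distinct_list[OF pair_finite_verts] by blast
  define vs where "vs = sort_key ?l ws"
  have vs: "distinct vs" "set vs = pverts T" and sorted: "sorted (map ?l vs)"
    using ws by (simp_all add: vs_def)
  have len: "length vs = n" using vs assms(3) distinct_card by fastforce
  define A where "A = level_matrix T r vs"
  define B where "B = level_matrix (rooted_path n) 0 [0..<n]"
  have A: "A \<in> carrier_mat n n" using level_matrix_carrier[of T r vs] by (simp add: A_def len)
  have B: "B \<in> carrier_mat n n"
    using level_matrix_carrier[of "rooted_path n" 0 "[0..<n]"] by (simp add: B_def)
  have Aij: "A $$ (i, j) = \<bar>real (?l (vs ! i)) - real (?l (vs ! j))\<bar>" if "i < n" "j < n" for i j
    using that by (simp add: A_def level_matrix_def len)
  have Bij: "B $$ (i, j) = \<bar>real i - real j\<bar>" if "i < n" "j < n" for i j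
    using that by (simp add: B_def level_matrix_def level_rooted_path)
  have EA: "level_energy T r = energy A"
    unfolding A_def by (rule level_energy_eq[OF vs])
  have EB: "level_energy (rooted_path n) 0 = energy B"
    unfolding B_def by (rule level_energy_eq) (auto simp: rooted_path_def)
  have down: "k \<in> set (map ?l vs)" if "Suc k \<in> set (map ?l vs)" for k
    using rooted_tree_levels_downward_closed[OF assms(2)] that vs(2) by simp
  have le': "A $$ (i, j) \<le> B $$ (i, j)" if ij: "i < n" "j < n" "i \<le> j" for i j
  proof -
    have "?l (vs ! i) \<le> ?l (vs ! j)"
      using sorted_nth_mono[OF sorted, of i j] ij len by simp
    moreover have "?l (vs ! j) \<le> ?l (vs ! i) + (j - i)"
      using sorted_downward_closed_gap[OF sorted down, of i j] ij len by simp
    ultimately show ?thesis using ij by (simp add: Aij Bij)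
  qed
  have le: "A $$ (i, j) \<le> B $$ (i, j)" if "i < n" "j < n" for i j
    using that le'[of i j] le'[of j i] by (cases "i \<le> j") (auto simp: Aij Bij abs_minus_commute)
  have n: "0 < n" using assms(1) by simp
  note mono = energy_mono_negative_type[OF A B n level_matrix_negative_type[of T r vs, folded A_def]
      level_matrix_negative_type[of "rooted_path n" 0 "[0..<n]", folded B_def] _ le]
  have "energy A \<le> energy B" by (rule mono(1)) (simp_all add: Aij)
  moreover have "rooted_iso T r (rooted_path n) 0" if "energy A = energy B"
  proof -
    have AB: "A = B" by (rule mono(2)) (use that in \<open>simp_all add: Aij Bij\<close>)
    have "i = j" if "i < n" "j < n" "?l (vs ! i) = ?l (vs ! j)" for i j
      using Aij[OF that(1,2)] Bij[OF that(1,2)] that(3) by (simp add: AB)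
    hence "distinct (map ?l vs)"
      by (auto simp: distinct_conv_nth len)
    hence inj: "inj_on ?l (pverts T)" using vs by (simp add: distinct_map)
    have "?l v < n" if "v \<in> pverts T" for v
    proof -
      obtain i where i: "i < n" "v = vs ! i"
        using \<open>v \<in> pverts T\<close> len unfolding vs(2)[symmetric] in_set_conv_nth by auto
      have "r \<in> set vs" using assms(2) vs(2) by (simp add: rooted_tree_def)
      then obtain j where j: "j < n" "r = vs ! j" using len unfolding in_set_conv_nth by auto
      have "real (?l v) = \<bar>real i - real j\<bar>"
        using Aij[OF i(1) j(1)] Bij[OF i(1) j(1)] level_root[of r] assms(2) i j
        by (simp add: AB rooted_tree_def)
      thus ?thesis using i j by linarith
    qed
    hence "?l ` pverts T = {..<n}"
      using card_image[OF inj] assms(3) by (intro card_subset_eq) auto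
    thus ?thesis using inj rooted_iso_path_of_bij_levels[OF assms(2)] by (simp add: bij_betw_def)
  qed
  ultimately show ?thesis
    using level_energy_rooted_iso[OF assms(2), of "rooted_path n" 0] EA EB by auto
qed

end
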